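(* Let $n,r\ge 1$ be integers and let $A_1,\dots,A_n,B_1,\dots,B_n,C$ be matrices in $\mathbb{C}^{r\times r}$ such that $C+kI$ is invertible for all integers $k\ge 0$, and such that $A_iA_j=A_jA_i$, $B_iB_j=B_jB_i$ and $CB_j=B_jC$ for all $i,j=1,\dots,n$. Then the matrix function $U=F_{\mathcal{B}}[A_1,\dots,A_n,B_1,\dots,B_n;C;x_1,\dots,x_n]$ satisfies, on the interior of the region of absolute convergence of its defining series, the system of partial matrix differential equations $$x_i(1-x_i)\,U_{x_ix_i}+\sum_{\substack{j=1\\ j\ne i}}^{n} x_j\,U_{x_ix_j}-x_i(A_i+I)U_{x_i}-x_iU_{x_i}B_i+U_{x_i}C-A_i\,U\,B_i=0,\qquad i=1,\dots,n.$$
   Context: For $M\in\mathbb{C}^{r\times r}$, the Pochhammer symbol is $(M)_0=I$ and $(M)_k=M(M+I)\cdots(M+(k-1)I)$ for $k\ge1$; $(M)_k^{-1}$ denotes the inverse matrix of $(M)_k$. Matrix products are taken in the written order. For complex variables $x_1,\dots,x_n$, $$F_{\mathcal{B}}[A_1,\dots,A_n,B_1,\dots,B_n;C;x_1,\dots,x_n]=\sum_{m_1,\dots,m_n=0}^{\infty}(A_1)_{m_1}\cdots(A_n)_{m_n}(B_1)_{m_1}\cdots(B_n)_{m_n}(C)_{m_1+\cdots+m_n}^{-1}\,\frac{x_1^{m_1}\cdots x_n^{m_n}}{m_1!\cdots m_n!}.$$ Subscripts denote partial derivatives: $U_{x_i}=\partial U/\partial x_i$, $U_{x_ix_j}=\partial^2U/\partial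 x_i\partial x_j$. *)

theory Defs
  imports "HOL-Analysis.Analysis"
begin

text \<open>
  The numerator products are products of matrices in the written order, so the index type
  \<open>'n\<close> of the variables \<open>x\<^sub>1, \<dots>, x\<^sub>n\<close> carries a linear order besides being finite.
  On square matrices the library's \<open>*\<close> and \<open>pochhammer\<close> are not usable: the ring multiplication
  is \<open>**\<close> and the unit is \<open>mat 1\<close>.
\<close>

primrec mat_pochhammer :: "complex^'r^'r \<Rightarrow> nat \<Rightarrow> complex^'r^'r" where
  "mat_pochhammer M 0 = mat 1"
| "mat_pochhammer M (Suc k) = mat_pochhammer M k ** (M + mat (of_nat k))"

definition ordered_mat_prod :: "('n::{finite,linorder} \<Rightarrow> complex^'r^'r) \<Rightarrow> complex^'r^'r" where
  "ordered_mat_prod f = foldr (\<lambda>i P. f i ** P) (sorted_list_of_set UNIV) (mat 1)"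

definition mat_scale :: "complex \<Rightarrow> complex^'r^'r \<Rightarrow> complex^'r^'r" (infixr "*\<^sub>M" 75) where
  "c *\<^sub>M M = (\<chi> a b. c * M $ a $ b)"

definition FB_term ::
  "('n::{finite,linorder} \<Rightarrow> complex^'r^'r) \<Rightarrow> ('n::{finite,linorder} \<Rightarrow> complex^'r^'r) \<Rightarrow> complex^'r^'r
    \<Rightarrow> complex^'n::{finite,linorder} \<Rightarrow> ('n::{finite,linorder} \<Rightarrow> nat) \<Rightarrow> complex^'r^'r" where
  "FB_term A B C x m =
     (\<Prod>i\<in>UNIV. x $ i ^ m i / fact (m i)) *\<^sub>M
       (ordered_mat_prod (\<lambda>i. mat_pochhammer (A i) (m i)) **
        ordered_mat_prod (\<lambda>i. mat_pochhammer (B i) (m i)) **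
        matrix_inv (mat_pochhammer C (\<Sum>i\<in>UNIV. m i)))"

text \<open>
  The sum is the unordered sum over all multi-indices; it is only used where the series
  converges absolutely, and it is \<open>0\<close> by convention where the family is not summable.
\<close>

definition FB ::
  "('n::{finite,linorder} \<Rightarrow> complex^'r^'r) \<Rightarrow> ('n::{finite,linorder} \<Rightarrow> complex^'r^'r) \<Rightarrow> complex^'r^'r
    \<Rightarrow> complex^'n::{finite,linorder} \<Rightarrow> complex^'r^'r" where
  "FB A B C x = (\<Sum>\<^sub>\<infinity>m. FB_term A B C x m)"

definition FB_region ::
  "('n::{finite,linorder} \<Rightarrow> complex^'r^'r) \<Rightarrow> ('n::{finite,linorder} \<Rightarrow> complex^'r^'r) \<Rightarrow> complex^'r^'r
    \<Rightarrow> (complex^'n::{finite,linorder}) set" where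
  "FB_region A B C = {x. (\<lambda>m. norm (FB_term A B C x m)) summable_on UNIV}"

definition set_coord :: "complex^'n \<Rightarrow> 'n \<Rightarrow> complex \<Rightarrow> complex^'n" where
  "set_coord x i t = (\<chi> k. if k = i then t else x $ k)"

text \<open>
  Complex partial derivatives of matrix-valued functions, taken entrywise. As \<open>deriv\<close> is a
  total function, existence of the derivative is a separate predicate.
\<close>

definition has_partial ::
  "(complex^'n \<Rightarrow> complex^'r^'r) \<Rightarrow> 'n \<Rightarrow> complex^'n \<Rightarrow> bool" where
  "has_partial U i x \<longleftrightarrow>
     (\<forall>a b. (\<lambda>t. U (set_coord x i t) $ a $ b) field_differentiable (at (x $ i)))"

definition partial ::
  "'n \<Rightarrow> (complex^'n \<Rightarrow> complex^'r^'r) \<Rightarrow> complex^'n \<Rightarrow> complex^'r^'r" where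
  "partial i U x = (\<chi> a b. deriv (\<lambda>t. U (set_coord x i t) $ a $ b) (x $ i))"

end

theory Submission
  imports Defs "HOL-Complex_Analysis.Cauchy_Integral_Formula"
begin

text \<open>
  Write \<open>U = \<Sum>\<^sub>m K(m) x\<^sup>m / m!\<close> with coefficients \<open>K = FB_coeff A B C\<close>. For such an exponential
  power series, \<open>\<partial>/\<partial>x\<^sub>i\<close> shifts the coefficients, replacing \<open>K(m)\<close> by \<open>K(m + e\<^sub>i)\<close>, and
  multiplication by \<open>x\<^sub>i\<close> turns shifted coefficients \<open>K(m + e\<^sub>i)\<close> into \<open>m\<^sub>i K(m)\<close>. With
  \<open>|m| = m\<^sub>1 + \<dots> + m\<^sub>n\<close>, the \<open>m\<close>-th coefficient of the left-hand side of the equation is therefore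
  \<open>K(m + e\<^sub>i) (C + |m|) - (A\<^sub>i + m\<^sub>i) K(m) (B\<^sub>i + m\<^sub>i)\<close>,
  and the equation is the first-order recurrence expressing that this vanishes
  (\<open>FB_coeff_recurrence\<close>). The recurrence is where the commutation hypotheses enter: the \<open>A\<^sub>j\<close>
  commute, so the new factor \<open>A\<^sub>i + m\<^sub>i\<close> moves to the far left; \<open>B\<^sub>i + m\<^sub>i\<close> commutes with the other
  \<open>B\<^sub>j\<close> and with \<open>C\<close>, so it moves to the far right, past the inverse of \<open>(C)\<^sub>|\<^sub>m\<^sub>|\<close>; and the last
  factor of \<open>(C)\<^sub>|\<^sub>m\<^sub>|\<^sub>+\<^sub>1\<close> cancels \<open>C + |m|\<close>.

  The analytic part is termwise differentiation. An interior point of the region of absolute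
  convergence lies in an open polydisc contained in the region (\<open>interior_FB_region_polydisc\<close>):
  move every coordinate slightly away from the origin and compare terms. On a polydisc the series
  converges locally uniformly in each variable, so the Weierstrass theorem allows termwise
  differentiation (\<open>partial_has_exp_sum\<close>); as its conclusion has the form of its hypothesis, it can
  be iterated to obtain second derivatives.
\<close>

section \<open>Matrix algebra\<close>

lemma mat_scale_nth [simp]: "(c *\<^sub>M M) $ a $ b = c * M $ a $ b"
  by (simp add: mat_scale_def)

lemma matrix_mult_scale_right: "X ** (c *\<^sub>M Y) = c *\<^sub>M (X ** Y)"
  by (simp add: vec_eq_iff matrix_matrix_mult_def sum_distrib_left mult_ac)

lemma matrix_mult_scale_left: "(c *\<^sub>M X) ** Y = c *\<^sub>M (X ** Y)"
  by (simp add: vec_eq_iff matrix_matrix_mult_def sum_distrib_left mult_ac)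

lemma matrix_add_rdistrib: "(X + Y) ** Z = X ** Z + Y ** Z"
  by (simp add: vec_eq_iff matrix_matrix_mult_def distrib_right sum.distrib)

lemma mat_eq_scale: "mat c = c *\<^sub>M mat 1"
  by (simp add: vec_eq_iff mat_def)

lemma mat_scale_scale: "c *\<^sub>M d *\<^sub>M X = (c * d) *\<^sub>M X"
  by (simp add: vec_eq_iff)

lemma mat_mult_left: "mat c ** X = c *\<^sub>M X" for X :: "complex^'r^'r"
  by (subst mat_eq_scale) (simp add: matrix_mult_scale_left)

lemma mat_mult_right: "X ** mat c = c *\<^sub>M X" for X :: "complex^'r^'r"
  by (subst mat_eq_scale) (simp add: matrix_mult_scale_right)

lemma mat_scale_diff_left: "(c - d) *\<^sub>M X = c *\<^sub>M X - d *\<^sub>M X"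
  by (simp add: vec_eq_iff algebra_simps)

lemma mat_scale_sum: "(\<Sum>j\<in>J. c j) *\<^sub>M X = (\<Sum>j\<in>J. c j *\<^sub>M X)"
  by (simp add: vec_eq_iff sum_component sum_distrib_right)

lemma norm_mat_scale: "norm (c *\<^sub>M X) = cmod c * norm X"
proof -
  have "L2_set (\<lambda>b. cmod c * cmod (X $ a $ b)) UNIV = cmod c * L2_set (\<lambda>b. cmod (X $ a $ b)) UNIV" for a
    by (simp add: L2_set_right_distrib)
  then show ?thesis
    by (simp add: norm_vec_def norm_mult L2_set_right_distrib)
qed

definition commute :: "complex^'r^'r \<Rightarrow> complex^'r^'r \<Rightarrow> bool" where
  "commute X Y \<longleftrightarrow> X ** Y = Y ** X"

lemma commute_sym: "commute X Y \<Longrightarrow> commute Y X"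
  by (simp add: commute_def)

lemma commute_mat: "commute X (mat c)"
  by (simp add: commute_def mat_mult_left mat_mult_right)

lemma commute_add: "commute X Y \<Longrightarrow> commute X Z \<Longrightarrow> commute X (Y + Z)"
  by (simp add: commute_def matrix_add_ldistrib matrix_add_rdistrib)

lemma commute_mult:
  assumes "commute X Y" "commute X Z"
  shows "commute X (Y ** Z)"
  using assms unfolding commute_def by (metis matrix_mul_assoc)

lemma commute_mat_pochhammer: "commute X M \<Longrightarrow> commute X (mat_pochhammer M k)"
  by (induction k) (simp_all add: commute_mat commute_mult commute_add)

lemma commute_shift: "commute X Y \<Longrightarrow> commute (X + mat c) Y"
  by (meson commute_add commute_mat commute_sym)

lemma commute_ordered_mat_prod:
  assumes "\<And>j. commute X (f j)"
  shows "commute X (ordered_mat_prod f)"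
proof -
  have "commute X (foldr (\<lambda>i P. f i ** P) js (mat 1))" for js
    by (induction js) (simp_all add: commute_mat commute_mult assms)
  then show ?thesis by (simp add: ordered_mat_prod_def)
qed

lemma matrix_inv_mult_self:
  fixes X :: "complex^'r^'r"
  assumes "invertible X"
  shows "X ** matrix_inv X = mat 1" "matrix_inv X ** X = mat 1"
  using assms unfolding invertible_def matrix_inv_def by (metis (mono_tags, lifting) someI_ex)+

lemma commute_matrix_inv:
  assumes "commute X Y" "invertible Y"
  shows "commute X (matrix_inv Y)"
proof -
  have "matrix_inv Y ** (X ** Y) ** matrix_inv Y = matrix_inv Y ** (Y ** X) ** matrix_inv Y"
    using assms(1) by (simp add: commute_def)
  moreover have "matrix_inv Y ** (X ** Y) ** matrix_inv Y = matrix_inv Y ** X ** (Y ** matrix_inv Y)"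
    "matrix_inv Y ** (Y ** X) ** matrix_inv Y = (matrix_inv Y ** Y) ** X ** matrix_inv Y"
    by (simp_all only: matrix_mul_assoc)
  ultimately show ?thesis
    by (simp add: commute_def matrix_inv_mult_self[OF assms(2)])
qed

text \<open>
  The inverse of a product reverses the factors, so cancelling the last factor requires the two to
  commute.
\<close>

lemma matrix_inv_mult_cancel:
  assumes "commute X Y" "invertible X" "invertible Y"
  shows "matrix_inv (X ** Y) ** Y = matrix_inv X"
proof -
  have "matrix_inv (X ** Y) ** (Y ** X) = mat 1"
    using assms invertible_mult[of X Y] by (simp add: matrix_inv_mult_self(2) commute_def)
  then have "(matrix_inv (X ** Y) ** Y) ** (X ** matrix_inv X) = matrix_inv X"
    by (metis matrix_mul_assoc matrix_mul_lid)
  then show ?thesis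
    by (simp add: matrix_inv_mult_self(1)[OF assms(2)])
qed

lemma invertible_mat_pochhammer:
  assumes "\<And>k::nat. invertible (C + mat (of_nat k) :: complex^'r^'r)"
  shows "invertible (mat_pochhammer C k)"
proof (induction k)
  case 0
  show ?case by (auto simp: invertible_def intro: exI[of _ "mat 1"])
next
  case (Suc k)
  then show ?case by (simp add: assms invertible_mult)
qed

lemma mat_pochhammer_Suc_left:
  "mat_pochhammer M (Suc k) = (M + mat (of_nat k)) ** mat_pochhammer M k"
  using commute_shift[OF commute_mat_pochhammer, of M M "of_nat k" k]
  by (simp add: commute_def)

text \<open>
  A left factor of one entry of an ordered product can be moved to the front, past the entries
  before it, if it commutes with these.
\<close>

lemma ordered_mat_prod_pull_left:
  assumes "g i = X ** f i" and "\<And>j. j \<noteq> i \<Longrightarrow> g j = f j" and "\<And>j. commute X (f j)"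
  shows "ordered_mat_prod g = X ** ordered_mat_prod f"
proof -
  let ?prod = "\<lambda>h js. foldr (\<lambda>i P. h i ** P) js (mat 1)"
  have same: "?prod g js = ?prod f js" if "i \<notin> set js" for js
    using that by (induction js) (auto simp: assms(2))
  have "?prod g js = X ** ?prod f js" if "distinct js" "i \<in> set js" for js
    using that
  proof (induction js)
    case (Cons j js)
    show ?case
    proof (cases "j = i")
      case True
      then show ?thesis using Cons.prems same[of js] by (simp add: assms(1) matrix_mul_assoc)
    next
      case False
      then have "?prod g (j # js) = f j ** (X ** ?prod f js)"
        using Cons by (simp add: assms(2))
      also have "\<dots> = X ** ?prod f (j # js)"
        using assms(3)[of j] by (simp add: commute_def matrix_mul_assoc)
      finally show ?thesis .
    qed
  qed simp
  then show ?thesis by (simp add: ordered_mat_prod_def)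
qed

section \<open>The recurrence for the coefficients\<close>

definition inc :: "'n \<Rightarrow> ('n \<Rightarrow> nat) \<Rightarrow> 'n \<Rightarrow> nat" where
  "inc i m = m(i := Suc (m i))"

lemma inc_same [simp]: "inc i m i = Suc (m i)"
  and inc_other: "j \<noteq> i \<Longrightarrow> inc i m j = m j"
  by (simp_all add: inc_def)

lemma inc_commute: "inc i (inc j m) = inc j (inc i m)"
  by (auto simp: inc_def fun_upd_def fun_eq_iff)

lemma sum_inc: "(\<Sum>k\<in>UNIV. inc i m k) = Suc (\<Sum>k\<in>UNIV. m k)" for m :: "'n::finite \<Rightarrow> nat"
proof -
  have "(\<Sum>k\<in>UNIV - {i}. inc i m k) = (\<Sum>k\<in>UNIV - {i}. m k)"
    by (rule sum.cong) (auto simp: inc_other)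
  then show ?thesis by (simp add: sum.remove[of UNIV i])
qed

definition FB_coeff ::
  "('n::{finite,linorder} \<Rightarrow> complex^'r^'r) \<Rightarrow> ('n \<Rightarrow> complex^'r^'r) \<Rightarrow> complex^'r^'r
    \<Rightarrow> ('n \<Rightarrow> nat) \<Rightarrow> complex^'r^'r" where
  "FB_coeff A B C m =
     ordered_mat_prod (\<lambda>i. mat_pochhammer (A i) (m i)) **
     ordered_mat_prod (\<lambda>i. mat_pochhammer (B i) (m i)) **
     matrix_inv (mat_pochhammer C (\<Sum>i\<in>UNIV. m i))"

lemma ordered_mat_prod_pochhammer_inc:
  assumes "\<And>i j. commute (A i) (A j)"
  shows "ordered_mat_prod (\<lambda>j. mat_pochhammer (A j) (inc i m j)) =
    (A i + mat (of_nat (m i))) ** ordered_mat_prod (\<lambda>j. mat_pochhammer (A j) (m j))"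
proof (rule ordered_mat_prod_pull_left)
  show "mat_pochhammer (A i) (inc i m i) = (A i + mat (of_nat (m i))) ** mat_pochhammer (A i) (m i)"
    using mat_pochhammer_Suc_left[of "A i" "m i"] by simp
qed (simp_all add: inc_other commute_shift commute_mat_pochhammer assms)

lemma FB_coeff_recurrence:
  assumes C_inv: "\<And>k::nat. invertible (C + mat (of_nat k))"
    and A_comm: "\<And>i j. commute (A i) (A j)"
    and B_comm: "\<And>i j. commute (B i) (B j)"
    and CB_comm: "\<And>j. commute C (B j)"
  shows "FB_coeff A B C (inc i m) ** (C + mat (of_nat (\<Sum>k\<in>UNIV. m k)))
    = (A i + mat (of_nat (m i))) ** FB_coeff A B C m ** (B i + mat (of_nat (m i)))"
proof -
  let ?M = "\<Sum>k\<in>UNIV. m k"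
  define PA PB where "PA = ordered_mat_prod (\<lambda>j. mat_pochhammer (A j) (m j))"
    and "PB = ordered_mat_prod (\<lambda>j. mat_pochhammer (B j) (m j))"
  define Q D where "Q = mat_pochhammer C ?M" and "D = C + mat (of_nat ?M)"
  define a b where "a = A i + mat (of_nat (m i))" and "b = B i + mat (of_nat (m i))"
  have inv: "invertible Q" "invertible D"
    using C_inv invertible_mat_pochhammer[OF C_inv] by (auto simp: Q_def D_def simp del: of_nat_sum)
  have "commute Q D"
    unfolding Q_def D_def
    by (intro commute_sym[OF commute_shift] commute_mat_pochhammer) (simp add: commute_def)
  then have cancel: "matrix_inv (Q ** D) ** D = matrix_inv Q"
    by (rule matrix_inv_mult_cancel[OF _ inv])
  have "commute b Q" "commute b PB"
    unfolding b_def Q_def PB_def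
    by (intro commute_shift commute_mat_pochhammer commute_sym[OF CB_comm]
        commute_ordered_mat_prod B_comm)+
  then have "commute b (PB ** matrix_inv Q)"
    by (intro commute_mult commute_matrix_inv inv)
  moreover have "FB_coeff A B C (inc i m) ** D = a ** PA ** (b ** PB) ** matrix_inv (Q ** D) ** D"
    by (simp add: FB_coeff_def ordered_mat_prod_pochhammer_inc A_comm B_comm sum_inc
        PA_def PB_def Q_def D_def a_def b_def del: of_nat_sum)
  moreover have "\<dots> = a ** PA ** (b ** (PB ** matrix_inv Q))"
    using cancel by (simp add: matrix_mul_assoc[symmetric])
  ultimately show ?thesis
    by (simp add: FB_coeff_def commute_def PA_def PB_def Q_def D_def a_def b_def matrix_mul_assoc)
qed

section \<open>Exponential power series with matrix coefficients\<close>

definition exp_monomial :: "complex^'n \<Rightarrow> ('n \<Rightarrow> nat) \<Rightarrow> complex" where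
  "exp_monomial x m = (\<Prod>k\<in>UNIV. x $ k ^ m k / fact (m k))"

definition has_exp_sum ::
  "(('n \<Rightarrow> nat) \<Rightarrow> complex^'r^'r) \<Rightarrow> complex^'n \<Rightarrow> complex^'r^'r \<Rightarrow> bool" where
  "has_exp_sum K x S \<longleftrightarrow> ((\<lambda>m. exp_monomial x m *\<^sub>M K m) has_sum S) UNIV"

lemma has_sum_matrix_iff:
  fixes f :: "'a \<Rightarrow> complex^'r^'r"
  shows "(f has_sum S) I \<longleftrightarrow> (\<forall>a b. ((\<lambda>m. f m $ a $ b) has_sum S $ a $ b) I)"
proof
  assume "(f has_sum S) I"
  then have "((\<lambda>F. sum f F $ a $ b) \<longlongrightarrow> S $ a $ b) (finite_subsets_at_top I)" for a b
    unfolding has_sum_def by (intro tendsto_vec_nth)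
  then show "\<forall>a b. ((\<lambda>m. f m $ a $ b) has_sum S $ a $ b) I"
    by (simp add: has_sum_def sum_component)
next
  assume "\<forall>a b. ((\<lambda>m. f m $ a $ b) has_sum S $ a $ b) I"
  then show "(f has_sum S) I"
    unfolding has_sum_def by (intro vec_tendstoI) (simp add: sum_component)
qed

lemma has_sum_linear_matrix:
  fixes f :: "'a \<Rightarrow> complex^'r^'r" and h :: "complex^'r^'r \<Rightarrow> complex^'r^'r"
  assumes "linear h" "(f has_sum S) I"
  shows "((\<lambda>m. h (f m)) has_sum h S) I"
  using has_sum_bounded_linear[of h f I S] assms by (simp add: linear_conv_bounded_linear o_def)

lemma linear_matrix_mult_left: "linear (\<lambda>Y. X ** Y)" for X :: "complex^'r^'r"
  by (rule linearI) (simp_all add: vec_eq_iff matrix_matrix_mult_def algebra_simps sum.distrib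
      scaleR_sum_right)

lemma linear_matrix_mult_right: "linear (\<lambda>Y. Y ** X)" for X :: "complex^'r^'r"
  by (rule linearI) (simp_all add: vec_eq_iff matrix_matrix_mult_def algebra_simps sum.distrib
      scaleR_sum_right)

lemma linear_mat_scale: "linear (\<lambda>Y. c *\<^sub>M Y)"
  by (rule linearI) (simp_all add: vec_eq_iff algebra_simps)

lemma has_exp_sum_mult_left:
  "has_exp_sum K x S \<Longrightarrow> has_exp_sum (\<lambda>m. X ** K m) x (X ** S)"
  unfolding has_exp_sum_def
  by (drule has_sum_linear_matrix[OF linear_matrix_mult_left[of X]])
    (simp add: matrix_mult_scale_right)

lemma has_exp_sum_mult_right:
  "has_exp_sum K x S \<Longrightarrow> has_exp_sum (\<lambda>m. K m ** X) x (S ** X)"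
  unfolding has_exp_sum_def
  by (drule has_sum_linear_matrix[OF linear_matrix_mult_right[of X]])
    (simp add: matrix_mult_scale_left)

lemma has_exp_sum_add:
  assumes "has_exp_sum K x S" "has_exp_sum L x T"
  shows "has_exp_sum (\<lambda>m. K m + L m) x (S + T)"
  using has_sum_add[OF assms[unfolded has_exp_sum_def]]
  by (simp add: has_exp_sum_def linear_add[OF linear_mat_scale])

lemma has_exp_sum_diff:
  assumes "has_exp_sum K x S" "has_exp_sum L x T"
  shows "has_exp_sum (\<lambda>m. K m - L m) x (S - T)"
proof -
  have "has_exp_sum (\<lambda>m. - L m) x (- T)"
    using assms(2)
    by (simp add: has_exp_sum_def has_sum_uminus linear_neg[OF linear_mat_scale])
  from has_exp_sum_add[OF assms(1) this] show ?thesis by simp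
qed

lemma has_exp_sum_sum:
  assumes "finite J" "\<And>j. j \<in> J \<Longrightarrow> has_exp_sum (K j) x (S j)"
  shows "has_exp_sum (\<lambda>m. \<Sum>j\<in>J. K j m) x (\<Sum>j\<in>J. S j)"
  using assms
proof (induction rule: finite_induct)
  case empty
  show ?case by (simp add: has_exp_sum_def linear_0[OF linear_mat_scale])
next
  case (insert j J)
  then show ?case by (simp add: has_exp_sum_add)
qed

lemma has_exp_sum_unique:
  "has_exp_sum K x S \<Longrightarrow> has_exp_sum K x T \<Longrightarrow> S = T"
  unfolding has_exp_sum_def by (rule has_sum_unique)

lemma has_sum_inc_iff:
  assumes "\<And>m. m i = 0 \<Longrightarrow> g m = 0"
  shows "((\<lambda>m. g (inc i m)) has_sum S) UNIV \<longleftrightarrow> (g has_sum S) UNIV"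
proof -
  have "bij_betw (inc i) UNIV {m. m i > 0}"
    by (rule bij_betw_byWitness[where f' = "\<lambda>m. m(i := m i - 1)"]) (auto simp: inc_def)
  then have "((\<lambda>m. g (inc i m)) has_sum S) UNIV \<longleftrightarrow> (g has_sum S) {m. m i > 0}"
    by (rule has_sum_reindex_bij_betw)
  also have "\<dots> \<longleftrightarrow> (g has_sum S) UNIV"
    by (rule has_sum_cong_neutral) (auto simp: assms)
  finally show ?thesis .
qed

lemma exp_monomial_split:
  "exp_monomial x m = x $ i ^ m i / fact (m i) * (\<Prod>k\<in>UNIV - {i}. x $ k ^ m k / fact (m k))"
  unfolding exp_monomial_def by (subst prod.remove[of UNIV i]) auto

lemma exp_monomial_inc:
  "of_nat (Suc (m i)) * exp_monomial x (inc i m) = x $ i * exp_monomial x m"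
proof -
  have "(\<Prod>k\<in>UNIV - {i}. x $ k ^ inc i m k / fact (inc i m k)) =
        (\<Prod>k\<in>UNIV - {i}. x $ k ^ m k / fact (m k))"
    by (rule prod.cong) (auto simp: inc_other)
  moreover have "of_nat (Suc (m i)) * (x $ i ^ Suc (m i) / fact (Suc (m i))) =
      x $ i * (x $ i ^ m i / fact (m i))"
    unfolding fact_Suc power_Suc by (simp del: of_nat_Suc fact_Suc power_Suc)
  ultimately show ?thesis
    unfolding exp_monomial_split[of x _ i] inc_same mult.assoc[symmetric] by (simp only:)
qed

text \<open>
  Stated for shifted coefficients because \<open>m\<^sub>i K(m)\<close> vanishes for \<open>m\<^sub>i = 0\<close>: no value of \<open>K\<close> outside
  the image of the shift is involved, and the derivatives of a series have coefficients of exactly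
  this form.
\<close>

lemma has_exp_sum_mult_coord:
  assumes "has_exp_sum (\<lambda>m. K (inc i m)) x S"
  shows "has_exp_sum (\<lambda>m. of_nat (m i) *\<^sub>M K m) x (x $ i *\<^sub>M S)"
proof -
  let ?g = "\<lambda>m. (of_nat (m i) * exp_monomial x m) *\<^sub>M K m"
  have "((\<lambda>m. x $ i *\<^sub>M exp_monomial x m *\<^sub>M K (inc i m)) has_sum (x $ i *\<^sub>M S)) UNIV"
    using assms unfolding has_exp_sum_def by (rule has_sum_linear_matrix[OF linear_mat_scale])
  also have "(\<lambda>m. x $ i *\<^sub>M exp_monomial x m *\<^sub>M K (inc i m)) = (\<lambda>m. ?g (inc i m))"
    by (simp only: mat_scale_scale inc_same exp_monomial_inc)
  also have "(\<dots> has_sum (x $ i *\<^sub>M S)) UNIV \<longleftrightarrow> (?g has_sum (x $ i *\<^sub>M S)) UNIV"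
    by (rule has_sum_inc_iff) (simp add: vec_eq_iff)
  finally show ?thesis
    by (simp add: has_exp_sum_def mat_scale_scale mult.commute)
qed

section \<open>Termwise differentiation on a polydisc\<close>

definition polydisc :: "('n \<Rightarrow> real) \<Rightarrow> (complex^'n) set" where
  "polydisc R = {z. \<forall>k. cmod (z $ k) < R k}"

lemma norm_exp_monomial_mono:
  assumes "\<And>k. cmod (z $ k) \<le> cmod (y $ k)"
  shows "cmod (exp_monomial z m) \<le> cmod (exp_monomial y m)"
  unfolding exp_monomial_def
  by (simp add: prod_norm[symmetric] norm_divide norm_power)
    (intro prod_mono conjI divide_right_mono power_mono, auto simp: assms)

text \<open>
  The normalisation by \<open>m!\<close> makes differentiation lower the index without a numerical factor.
\<close>

lemma has_field_derivative_exp_monomial: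
  "((\<lambda>t. exp_monomial (set_coord z i t) m) has_field_derivative
      (if m i = 0 then 0 else exp_monomial (set_coord z i t) (m(i := m i - 1)))) (at t)"
proof -
  define P where "P = (\<Prod>k\<in>UNIV - {i}. z $ k ^ m k / fact (m k))"
  have factor: "exp_monomial (set_coord z i t) (m(i := l)) = t ^ l / fact l * P" for t l
    unfolding exp_monomial_split[of _ _ i] P_def
    by (auto simp: set_coord_def intro!: prod.cong)
  have eq: "exp_monomial (set_coord z i t) m = t ^ m i / fact (m i) * P" for t
    using factor[of t "m i"] by simp
  show ?thesis
  proof (cases "m i")
    case 0
    then show ?thesis by (simp add: eq)
  next
    case (Suc l)
    have "((\<lambda>t. t ^ Suc l / fact (Suc l) * P) has_field_derivative
        of_nat (Suc l) * t ^ l / fact (Suc l) * P) (at t)"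
      using DERIV_power[OF DERIV_ident, of "Suc l" t UNIV]
      by (intro DERIV_cmult_right DERIV_cdivide) simp
    moreover have "of_nat (Suc l) * t ^ l / fact (Suc l) = t ^ l / fact l"
      unfolding fact_Suc by (simp del: of_nat_Suc fact_Suc)
    ultimately show ?thesis
      using Suc by (simp add: eq factor del: of_nat_Suc fact_Suc)
  qed
qed

text \<open>
  A locally uniform limit of holomorphic functions may be differentiated under the limit. It is
  applied to the net of finite partial sums, whose limit is by definition the unordered sum, so it
  gives the summability of the differentiated series together with its value.
\<close>

lemma partial_has_exp_sum:
  fixes U :: "complex^'n::finite \<Rightarrow> complex^'r^'r"
  assumes U: "\<And>z. z \<in> polydisc R \<Longrightarrow> has_exp_sum K z (U z)"
    and z: "z \<in> polydisc R"
  shows "has_partial U i z" and "has_exp_sum (\<lambda>m. K (inc i m)) z (partial i U z)"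
proof -
  let ?Z = "set_coord z i"
  have z_coord: "?Z (z $ i) = z"
    by (simp add: set_coord_def vec_eq_iff)
  obtain \<rho> where \<rho>: "cmod (z $ i) < \<rho>" "\<rho> < R i"
    using z dense[of "cmod (z $ i)" "R i"] by (auto simp: polydisc_def)
  define r where "r = \<rho> - cmod (z $ i)"
  have r: "r > 0" using \<rho> by (simp add: r_def)
  \<comment> \<open>On the closed disc on which the partial sums converge uniformly, the terms are dominated by
      those at \<open>y\<close>, whose \<open>i\<close>-th coordinate has the largest modulus \<open>\<rho>\<close> that occurs there.\<close>
  have Z_coord_le: "cmod t \<le> \<rho>" if "t \<in> cball (z $ i) r" for t
    using that norm_triangle_sub[of t "z $ i"]
    by (simp add: r_def dist_norm norm_minus_commute)
  define y where "y = ?Z (of_real \<rho>)"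
  have \<rho>_pos: "\<rho> > 0" using \<rho>(1) norm_ge_zero le_less_trans by blast
  have in_disc: "?Z t \<in> polydisc R" if "cmod t \<le> \<rho>" for t
    using that z \<rho> by (auto simp: polydisc_def set_coord_def)
  have y: "y \<in> polydisc R"
    unfolding y_def using \<rho>_pos by (intro in_disc) simp
  have main: "\<exists>g'. ((\<lambda>t. U (?Z t) $ a $ b) has_field_derivative g') (at (z $ i)) \<and>
      ((\<lambda>m. exp_monomial z m * K (inc i m) $ a $ b) has_sum g') UNIV" for a b
  proof -
    define f where "f = (\<lambda>m t. exp_monomial (?Z t) m * K m $ a $ b)"
    define f' where "f' = (\<lambda>m t. (if m i = 0 then 0 else exp_monomial (?Z t) (m(i := m i - 1)))
      * K m $ a $ b)"
    define g where "g = (\<lambda>t. \<Sum>\<^sub>\<infinity>m. f m t)"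
    have sums: "((\<lambda>m. exp_monomial w m * K m $ a $ b) has_sum U w $ a $ b) UNIV"
      if "w \<in> polydisc R" for w
      using U[OF that] by (simp add: has_exp_sum_def has_sum_matrix_iff)
    have "(\<lambda>m. exp_monomial y m * K m $ a $ b) summable_on UNIV"
      using sums[OF y] by (auto simp: summable_on_def)
    then have M: "(\<lambda>m. cmod (exp_monomial y m * K m $ a $ b)) summable_on UNIV"
      by (simp only: summable_on_iff_abs_summable_on_complex)
    have bound: "cmod (f m t) \<le> cmod (exp_monomial y m * K m $ a $ b)"
      if "t \<in> cball (z $ i) r" for m t
      unfolding f_def norm_mult
      using Z_coord_le[OF that] \<rho>_pos
      by (intro mult_right_mono norm_exp_monomial_mono) (auto simp: y_def set_coord_def)
    have ulim: "uniform_limit (cball (z $ i) r) (\<lambda>X t. \<Sum>m\<in>X. f m t) g (finite_subsets_at_top UNIV)"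
      unfolding g_def by (rule Weierstrass_m_test_general[OF _ M]) (rule bound)
    have df: "(f m has_field_derivative f' m t) (at t)" for m t
      unfolding f_def f'_def by (rule DERIV_cmult_right[OF has_field_derivative_exp_monomial])
    have cont: "\<forall>\<^sub>F X in finite_subsets_at_top UNIV.
        continuous_on (cball (z $ i) r) (\<lambda>t. \<Sum>m\<in>X. f m t) \<and>
        (\<forall>w\<in>ball (z $ i) r. ((\<lambda>t. \<Sum>m\<in>X. f m t) has_field_derivative (\<Sum>m\<in>X. f' m w)) (at w))"
      using df by (intro always_eventually allI conjI ballI continuous_on_sum DERIV_sum
          DERIV_continuous_on[OF has_field_derivative_at_within])
    obtain g' where g': "(g has_field_derivative g' w) (at w)"
        "((\<lambda>X. \<Sum>m\<in>X. f' m w) \<longlongrightarrow> g' w) (finite_subsets_at_top UNIV)"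
      if "w \<in> ball (z $ i) r" for w
      by (rule has_complex_derivative_uniform_limit[OF cont ulim _ r]) auto
    have center: "z $ i \<in> ball (z $ i) r" using r by simp
    have "g t = U (?Z t) $ a $ b" if "t \<in> ball (z $ i) r" for t
      unfolding g_def f_def
      using that by (intro infsumI sums in_disc Z_coord_le) auto
    then have "((\<lambda>t. U (?Z t) $ a $ b) has_field_derivative g' (z $ i)) (at (z $ i))"
      using g'(1)[OF center] center by (blast intro: has_field_derivative_transform_within_open)
    moreover have "((\<lambda>m. f' m (z $ i)) has_sum g' (z $ i)) UNIV"
      using g'(2)[OF center] by (simp add: has_sum_def)
    then have "((\<lambda>m. f' (inc i m) (z $ i)) has_sum g' (z $ i)) UNIV"
      by (subst has_sum_inc_iff[of i "\<lambda>m. f' m (z $ i)"]) (simp_all add: f'_def)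
    then have "((\<lambda>m. exp_monomial z m * K (inc i m) $ a $ b) has_sum g' (z $ i)) UNIV"
      by (simp add: f'_def z_coord inc_def)
    ultimately show ?thesis by blast
  qed
  show "has_partial U i z"
    using main unfolding has_partial_def field_differentiable_def by blast
  show "has_exp_sum (\<lambda>m. K (inc i m)) z (partial i U z)"
    unfolding has_exp_sum_def has_sum_matrix_iff
  proof (intro allI)
    fix a b
    show "((\<lambda>m. (exp_monomial z m *\<^sub>M K (inc i m)) $ a $ b) has_sum partial i U z $ a $ b) UNIV"
      using main[of a b] by (auto simp: partial_def DERIV_imp_deriv)
  qed
qed

section \<open>The region of convergence\<close>

lemma FB_term_eq: "FB_term A B C x m = exp_monomial x m *\<^sub>M FB_coeff A B C m"
  by (simp add: FB_term_def exp_monomial_def FB_coeff_def)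

lemma has_exp_sum_FB:
  assumes "x \<in> FB_region A B C"
  shows "has_exp_sum (FB_coeff A B C) x (FB A B C x)"
  using abs_summable_summable[of "FB_term A B C x" UNIV] assms
  by (simp add: has_exp_sum_def FB_region_def FB_def FB_term_eq[abs_def])

text \<open>
  The witness \<open>y\<close> moves each coordinate of \<open>x\<close> radially outwards by \<open>\<delta>\<close>, in an arbitrary direction
  if that coordinate is \<open>0\<close>. It lies in the region, and its terms dominate those of any point of
  the polydisc that it spans.
\<close>

lemma interior_FB_region_polydisc:
  fixes A B :: "'n::{finite,linorder} \<Rightarrow> complex^'r^'r"
  assumes "x \<in> interior (FB_region A B C)"
  obtains R where "x \<in> polydisc R" "polydisc R \<subseteq> FB_region A B C"
proof -
  obtain e where e: "e > 0" "ball x e \<subseteq> FB_region A B C"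
    using assms by (auto simp: mem_interior)
  define \<delta> where "\<delta> = e / (2 * real CARD('n))"
  have \<delta>: "\<delta> > 0" using e by (simp add: \<delta>_def)
  define d where "d = (\<lambda>k. if x $ k = 0 then 1 else sgn (x $ k))"
  define y where "y = (\<chi> k. x $ k + of_real \<delta> * d k)"
  have norm_d: "cmod (d k) = 1" for k
    by (simp add: d_def norm_sgn)
  have norm_y: "cmod (y $ k) = cmod (x $ k) + \<delta>" for k
  proof -
    have "y $ k = of_real (cmod (x $ k) + \<delta>) * d k"
      by (auto simp: y_def d_def sgn_div_norm scaleR_conv_of_real field_simps)
    then have "cmod (y $ k) = \<bar>cmod (x $ k) + \<delta>\<bar> * cmod (d k)"
      by (simp only: norm_mult norm_of_real)
    then show ?thesis using \<delta> by (simp add: norm_d)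
  qed
  have "norm (x - y) \<le> (\<Sum>k\<in>UNIV. cmod ((x - y) $ k))"
    unfolding norm_vec_def by (rule L2_set_le_sum) simp
  also have "\<dots> = (\<Sum>k\<in>(UNIV :: 'n set). \<delta>)"
    using \<delta> by (intro sum.cong) (simp_all add: y_def norm_mult norm_d)
  also have "\<dots> = e / 2"
    by (simp add: \<delta>_def)
  finally have "y \<in> ball x e"
    using e by (simp add: dist_norm)
  then have y: "(\<lambda>m. norm (FB_term A B C y m)) summable_on UNIV"
    using e by (auto simp: FB_region_def)
  have "z \<in> FB_region A B C" if "z \<in> polydisc (\<lambda>k. cmod (y $ k))" for z
  proof -
    have "norm (FB_term A B C z m) \<le> norm (FB_term A B C y m)" for m
      unfolding FB_term_eq norm_mat_scale
      using that by (intro mult_right_mono norm_exp_monomial_mono) (auto simp: polydisc_def less_imp_le)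
    then show ?thesis
      unfolding FB_region_def using Infinite_Sum.abs_summable_on_comparison_test[OF y] by blast
  qed
  moreover have "x \<in> polydisc (\<lambda>k. cmod (y $ k))"
    using \<delta> by (simp add: polydisc_def norm_y)
  ultimately show thesis using that by blast
qed

section \<open>The differential equations\<close>

theorem theorem3p2:
  fixes A B :: "'n::{finite,linorder} \<Rightarrow> complex^'r^'r"
    and C :: "complex^'r^'r"
    and U :: "complex^'n::{finite,linorder} \<Rightarrow> complex^'r^'r"
  assumes C_inv: "\<And>k::nat. invertible (C + mat (of_nat k))"
    and A_comm: "\<And>i j. A i ** A j = A j ** A i"
    and B_comm: "\<And>i j. B i ** B j = B j ** B i"
    and CB_comm: "\<And>j. C ** B j = B j ** C"
    and U_eq: "U = FB A B C"
  shows "\<forall>x \<in> interior (FB_region A B C). \<forall>i.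
    has_partial U i x \<and> (\<forall>j. has_partial (partial j U) i x) \<and>
    (x $ i * (1 - x $ i)) *\<^sub>M partial i (partial i U) x
      + (\<Sum>j\<in>UNIV - {i}. x $ j *\<^sub>M partial i (partial j U) x)
      - x $ i *\<^sub>M ((A i + mat 1) ** partial i U x)
      - x $ i *\<^sub>M (partial i U x ** B i)
      + partial i U x ** C
      - A i ** U x ** B i = 0"
proof (intro ballI allI)
  fix x i
  assume "x \<in> interior (FB_region A B C)"
  then obtain R where x: "x \<in> polydisc R" and R: "polydisc R \<subseteq> FB_region A B C"
    by (rule interior_FB_region_polydisc)
  define K where "K = FB_coeff A B C"
  have U: "has_exp_sum K z (U z)" if "z \<in> polydisc R" for z
    unfolding K_def U_eq using that R by (intro has_exp_sum_FB) auto
  have U1: "has_exp_sum (\<lambda>m. K (inc j m)) z (partial j U z)" if "z \<in> polydisc R" for j z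
    by (rule partial_has_exp_sum(2)[OF U that])
  have U2: "has_exp_sum (\<lambda>m. K (inc i (inc j m))) x (partial i (partial j U) x)" for j
    using partial_has_exp_sum(2)[OF U1 x, of j i] by (subst inc_commute)
  have xU2: "has_exp_sum (\<lambda>m. of_nat (m j) *\<^sub>M K (inc i m)) x (x $ j *\<^sub>M partial i (partial j U) x)"
    for j
    by (rule has_exp_sum_mult_coord[OF U2])
  \<comment> \<open>In terms of the shifted index \<open>m + e\<^sub>i\<close>, the factor \<open>m\<^sub>i\<close> is its \<open>i\<close>-th entry minus one.\<close>
  have "has_exp_sum (\<lambda>m. of_nat (m i) *\<^sub>M (of_nat (m i) - 1) *\<^sub>M K m) x
      (x $ i *\<^sub>M x $ i *\<^sub>M partial i (partial i U) x)"
    by (rule has_exp_sum_mult_coord) (use xU2[of i] in simp)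
  from has_exp_sum_diff[OF xU2[of i] this]
  have U_ii: "has_exp_sum (\<lambda>m. of_nat (m i) *\<^sub>M K (inc i m) - of_nat (m i) *\<^sub>M (of_nat (m i) - 1) *\<^sub>M K m) x
      ((x $ i * (1 - x $ i)) *\<^sub>M partial i (partial i U) x)"
    by (simp add: mat_scale_scale mat_scale_diff_left right_diff_distrib)
  let ?L = "\<lambda>m. of_nat (m i) *\<^sub>M K (inc i m) - of_nat (m i) *\<^sub>M (of_nat (m i) - 1) *\<^sub>M K m
      + (\<Sum>j\<in>UNIV - {i}. of_nat (m j) *\<^sub>M K (inc i m))
      - of_nat (m i) *\<^sub>M ((A i + mat 1) ** K m)
      - of_nat (m i) *\<^sub>M (K m ** B i)
      + K (inc i m) ** C
      - A i ** K m ** B i"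
  let ?S = "(x $ i * (1 - x $ i)) *\<^sub>M partial i (partial i U) x
      + (\<Sum>j\<in>UNIV - {i}. x $ j *\<^sub>M partial i (partial j U) x)
      - x $ i *\<^sub>M ((A i + mat 1) ** partial i U x)
      - x $ i *\<^sub>M (partial i U x ** B i)
      + partial i U x ** C
      - A i ** U x ** B i"
  have "has_exp_sum ?L x ?S"
    by (intro has_exp_sum_add has_exp_sum_diff U_ii has_exp_sum_sum xU2 has_exp_sum_mult_coord
        has_exp_sum_mult_left has_exp_sum_mult_right U1 U x finite)
  moreover have "?L m = 0" for m
  proof -
    let ?c = "of_nat (m i) :: complex"
    have regroup: "c *\<^sub>M K\<^sub>i - c *\<^sub>M (c - 1) *\<^sub>M K\<^sub>0 + s *\<^sub>M K\<^sub>i - c *\<^sub>M (AK + K\<^sub>0) - c *\<^sub>M KB + KC - AKB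
        = (KC + (c + s) *\<^sub>M K\<^sub>i) - (AKB + c *\<^sub>M KB + c *\<^sub>M AK + (c * c) *\<^sub>M K\<^sub>0)"
      for c s and K\<^sub>0 K\<^sub>i AK KB KC AKB :: "complex^'r^'r"
      by (simp add: vec_eq_iff algebra_simps)
    have "K (inc i m) ** (C + mat (of_nat (\<Sum>k\<in>UNIV. m k))) = (A i + mat ?c) ** K m ** (B i + mat ?c)"
      unfolding K_def
      by (rule FB_coeff_recurrence) (simp_all add: C_inv A_comm B_comm CB_comm commute_def)
    moreover have "(of_nat (\<Sum>k\<in>UNIV. m k) :: complex) = ?c + (\<Sum>j\<in>UNIV - {i}. of_nat (m j))"
      by (simp add: sum.remove[of UNIV i])
    ultimately have "K (inc i m) ** C + (?c + (\<Sum>j\<in>UNIV - {i}. of_nat (m j))) *\<^sub>M K (inc i m)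
        = A i ** K m ** B i + ?c *\<^sub>M (K m ** B i) + ?c *\<^sub>M (A i ** K m) + (?c * ?c) *\<^sub>M K m"
      by (simp add: matrix_add_ldistrib matrix_add_rdistrib mat_mult_left mat_mult_right
          matrix_mult_scale_left matrix_mult_scale_right mat_scale_scale linear_add[OF linear_mat_scale]
          add_ac)
    then show ?thesis
      unfolding mat_scale_sum[symmetric]
      by (simp add: matrix_add_rdistrib regroup)
  qed
  ultimately have "has_exp_sum (\<lambda>m. 0) x ?S"
    by simp
  moreover have "has_exp_sum (\<lambda>m. 0) x 0"
    by (simp add: has_exp_sum_def linear_0[OF linear_mat_scale])
  ultimately have "?S = 0"
    by (rule has_exp_sum_unique)
  then show "has_partial U i x \<and> (\<forall>j. has_partial (partial j U) i x) \<and> ?S = 0"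
    using partial_has_exp_sum(1)[OF U x] partial_has_exp_sum(1)[OF U1 x] by blast
qed

end
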